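(* Let $A,B>0$, $k\in\mathbb R\setminus\{0\}$, and suppose $\chi_0$ is a triple spatial root, i.e. $F(\chi;\mu_0)=\mu_0(\chi-\chi_0)^3$ (see context). A nonzero vector of the form $$\mathbf y_R=M_0\mathbf Y_0+M_1\mathbf Y_1+\frac{M_2}{2}\mathbf Y_2,\qquad M_0,M_1,M_2\in\mathbb C,$$ can be $J$-null (i.e. $\langle\mathbf y_R|J|\mathbf y_R\rangle=0$) only if $M_0\neq0$. After the normalization $M_0=1$, the coefficients for which $\mathbf y_R$ is $J$-null are those satisfying $$g_{11}|M_1|^2+g_{02}\operatorname{Re}M_2+\operatorname{Re}\left(g_{12}M_1^*M_2\right)+\frac{g_{22}}{4}|M_2|^2=0 .$$
   Context: $S=A+B$, $R=A-B$; $a_1,a_2\in\mathbb R$ with $a_1^2=A$, $a_2^2=B$; $k_1=k$, $k_2=-k$; $\omega_1=1/k-A$, $\omega_2=-1/k-B$; $u_{j,0}=a_j\exp[\mathrm i(k_jx+\omega_jt)]$ for $(x,t)\in\mathbb R^2$. $F(\chi;\mu)=\mu\chi^3-2\chi^2+k^2(S-\mu)\chi+k^2(2-kR)$. At a triple root one has automatically $\chi_0\in\mathbb R$, $0<\chi_0<|k|$, $\mu_0=\frac{2}{3\chi_0}>0$; put $\lambda_0=\sqrt{\mu_0}>0$. $\nu(\chi)=\frac S2+\frac{2-kR}{2\chi}$, $E(\chi)=\exp[\mathrm i(\chi x+\nu(\chi)t)]$, $h_1(\chi)=\frac{k}{k+\chi}$, $h_2(\chi)=\frac{k}{k-\chi}$,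 $\mathbf y(\chi,\lambda)=(\lambda E(\chi),u_{1,0}h_1(\chi)E(\chi),u_{2,0}h_2(\chi)E(\chi))^{\mathsf T}$, and $\mathbf Y_n=\partial_\chi^n\mathbf y(\chi,\lambda_0)|_{\chi=\chi_0}$ (derivative at fixed $\lambda_0$). $J=\operatorname{diag}(1,-1,-1)$, $\langle\mathbf f|J|\mathbf g\rangle=\mathbf f^\dagger J\mathbf g$, $g_{mn}=\langle\mathbf Y_m|J|\mathbf Y_n\rangle$ for $0\le m,n\le2$; these are real constants independent of $(x,t)$. $^*$ is complex conjugation. *)

theory Defs
  imports "HOL-Complex_Analysis.Complex_Analysis"
begin

definition spatial_poly :: "real \<Rightarrow> real \<Rightarrow> real \<Rightarrow> complex \<Rightarrow> complex \<Rightarrow> complex" where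
  "spatial_poly A B k \<mu> z =
     \<mu> * z ^ 3 - 2 * z ^ 2 + of_real (k\<^sup>2) * (of_real (A + B) - \<mu>) * z
       + of_real (k\<^sup>2 * (2 - k * (A - B)))"

definition nu :: "real \<Rightarrow> real \<Rightarrow> real \<Rightarrow> complex \<Rightarrow> complex" where
  "nu A B k z = of_real ((A + B) / 2) + of_real (2 - k * (A - B)) / (2 * z)"

definition phase :: "real \<Rightarrow> real \<Rightarrow> real \<Rightarrow> real \<Rightarrow> real \<Rightarrow> complex \<Rightarrow> complex" where
  "phase A B k x t z = exp (\<i> * (z * of_real x + nu A B k z * of_real t))"

definition plane_wave :: "real \<Rightarrow> real \<Rightarrow> real \<Rightarrow> real \<Rightarrow> real \<Rightarrow> complex" where
  "plane_wave a \<kappa> \<omega> x t = of_real a * exp (\<i> * of_real (\<kappa> * x + \<omega> * t))"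

definition u10 :: "real \<Rightarrow> real \<Rightarrow> real \<Rightarrow> real \<Rightarrow> real \<Rightarrow> complex" where
  "u10 A a1 k x t = plane_wave a1 k (1 / k - A) x t"

definition u20 :: "real \<Rightarrow> real \<Rightarrow> real \<Rightarrow> real \<Rightarrow> real \<Rightarrow> complex" where
  "u20 B a2 k x t = plane_wave a2 (- k) (- 1 / k - B) x t"

definition h1 :: "real \<Rightarrow> complex \<Rightarrow> complex" where
  "h1 k z = of_real k / (of_real k + z)"

definition h2 :: "real \<Rightarrow> complex \<Rightarrow> complex" where
  "h2 k z = of_real k / (of_real k - z)"

definition yvec ::
    "real \<Rightarrow> real \<Rightarrow> real \<Rightarrow> real \<Rightarrow> real \<Rightarrow> real \<Rightarrow> real \<Rightarrow> complex \<Rightarrow> complex \<Rightarrow> complex ^ 3" where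
  "yvec A B a1 a2 k x t lam z =
     vector [lam * phase A B k x t z,
             u10 A a1 k x t * h1 k z * phase A B k x t z,
             u20 B a2 k x t * h2 k z * phase A B k x t z]"

(* The n-th derivative in the spectral root, at fixed x, t and lam, taken in each
   component as a complex derivative; at a real point it is the real one. *)
definition Yvec ::
    "real \<Rightarrow> real \<Rightarrow> real \<Rightarrow> real \<Rightarrow> real \<Rightarrow> complex \<Rightarrow> complex \<Rightarrow> nat \<Rightarrow> real \<Rightarrow> real \<Rightarrow> complex ^ 3" where
  "Yvec A B a1 a2 k lam z0 n x t =
     (\<chi> j. (deriv ^^ n) (\<lambda>z. yvec A B a1 a2 k x t lam z $ j) z0)"

definition Jmat :: "complex ^ 3 ^ 3" where
  "Jmat = vector [vector [1, 0, 0], vector [0, - 1, 0], vector [0, 0, - 1]]"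

definition Jform :: "complex ^ 3 \<Rightarrow> complex ^ 3 \<Rightarrow> complex" where
  "Jform f g = (\<Sum>i\<in>UNIV. cnj (f $ i) * (Jmat *v g) $ i)"

definition J_null :: "complex ^ 3 \<Rightarrow> bool" where
  "J_null f \<longleftrightarrow> Jform f f = 0"

(* The positive root lam0 of \<mu>0 is the principal complex square root: the triple-root
   identity forces \<mu>0 to be a positive real. *)
definition Ytriple ::
    "real \<Rightarrow> real \<Rightarrow> real \<Rightarrow> real \<Rightarrow> real \<Rightarrow> complex \<Rightarrow> complex \<Rightarrow> nat \<Rightarrow> real \<Rightarrow> real \<Rightarrow> complex ^ 3" where
  "Ytriple A B a1 a2 k \<mu>0 z0 n x t = Yvec A B a1 a2 k (csqrt \<mu>0) z0 n x t"

definition y_R ::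
    "real \<Rightarrow> real \<Rightarrow> real \<Rightarrow> real \<Rightarrow> real \<Rightarrow> complex \<Rightarrow> complex \<Rightarrow>
     complex \<Rightarrow> complex \<Rightarrow> complex \<Rightarrow> real \<Rightarrow> real \<Rightarrow> complex ^ 3" where
  "y_R A B a1 a2 k \<mu>0 z0 M0 M1 M2 x t =
     M0 *s Ytriple A B a1 a2 k \<mu>0 z0 0 x t + M1 *s Ytriple A B a1 a2 k \<mu>0 z0 1 x t
       + (M2 / 2) *s Ytriple A B a1 a2 k \<mu>0 z0 2 x t"

end

theory Submission
  imports Defs
begin

text \<open>Comparing coefficients shows that \<open>\<mu>0 > 0\<close> and \<open>z0\<close> is real, and evaluating at \<open>\<mp>k\<close> gives
  \<open>2 A k\<^sup>3 = \<mu>0 (k + z0)\<^sup>3\<close> and \<open>2 B k\<^sup>3 = \<mu>0 (k - z0)\<^sup>3\<close>. With these values the \<open>J\<close>-products of the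
  derivatives of the amplitudes \<open>(\<lambda>0, u10 h1, u20 h2)\<close> satisfy \<open>g00 = g01 = 0\<close> and \<open>g02 = 2 g11\<close>, and
  exactly these relations make all contributions of the phase \<open>E\<close> cancel, so that the Gram matrix
  does not depend on \<open>(x, t)\<close>. The null condition is then the expanded Hermitian form. On the span of
  \<open>Y1, Y2\<close> it agrees with the form on the derivatives of the amplitudes, which have vanishing first
  component and linearly independent remaining parts; there it is negative definite.\<close>

section \<open>Reality and sign of the triple root\<close>

lemma triple_root_parameters:
  fixes A B k :: real and \<mu>0 z0 :: complex
  assumes AB: "A > 0" "B > 0" and k: "k \<noteq> 0"
    and root: "\<forall>z. spatial_poly A B k \<mu>0 z = \<mu>0 * (z - z0) ^ 3"
  obtains m r where "\<mu>0 = of_real m" "z0 = of_real r" "m > 0" "r \<noteq> 0" "k + r \<noteq> 0" "k - r \<noteq> 0"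
    "2 * A * k ^ 3 = m * (k + r) ^ 3" "2 * B * k ^ 3 = m * (k - r) ^ 3"
proof -
  define K S C where "K = complex_of_real (k\<^sup>2)" and "S = complex_of_real (A + B)"
    and "C = complex_of_real (k\<^sup>2 * (2 - k * (A - B)))"
  have P: "\<mu>0 * z ^ 3 - 2 * z ^ 2 + K * (S - \<mu>0) * z + C = \<mu>0 * (z - z0) ^ 3" for z
    using root by (simp add: spatial_poly_def K_def S_def C_def)
  have c0: "C = - \<mu>0 * z0 ^ 3"
    using P[of 0] by simp
  \<comment> \<open>The sum of the identities at \<open>1\<close> and \<open>-1\<close> isolates the
    even coefficients.\<close>
  have c2: "3 * \<mu>0 * z0 = 2"
    using P[of 1] P[of "-1"] c0 by (simp add: power3_eq_cube) algebra
  have c1: "K * (S - \<mu>0) = 3 * \<mu>0 * z0\<^sup>2"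
    using P[of 1] c0 c2 by (simp add: power3_eq_cube power2_eq_square) algebra
  have z0_nz: "z0 \<noteq> 0" and mu_nz: "\<mu>0 \<noteq> 0"
    using c2 by auto
  have sq: "z0\<^sup>2 = complex_of_real (- 3 / 2 * (k\<^sup>2 * (2 - k * (A - B))))"
  proof -
    have "2 * z0\<^sup>2 = - 3 * C" using c0 c2 by algebra
    then have "z0\<^sup>2 = - 3 / 2 * C" by (simp add: field_simps)
    then show ?thesis by (simp add: C_def)
  qed
  \<comment> \<open>Multiplying \<open>c1\<close> by \<open>3 * z0\<close> and using
    \<open>c2\<close> eliminates \<open>\<mu>0\<close>. As \<open>sq\<close> makes the left side
    real and \<open>z0\<close> has a positive coefficient on the right, \<open>z0\<close> is real;
    then the left side is positive, hence so is \<open>z0\<close>.\<close>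
  have quad: "6 * z0\<^sup>2 + 2 * K = 3 * K * S * z0"
    using c1 c2 by algebra
  have "Im z0 = 0"
  proof (rule ccontr)
    assume im: "Im z0 \<noteq> 0"
    have "Im (z0\<^sup>2) = 0" using sq by (metis Im_complex_of_real)
    then have "Im (6 * z0\<^sup>2 + 2 * K) = 0"
      by (simp add: K_def)
    then have "Im (3 * K * S * z0) = 0" using quad by simp
    then have "3 * k\<^sup>2 * (A + B) * Im z0 = 0"
      by (simp add: K_def S_def)
    then show False using im AB k by simp
  qed
  then obtain r where r: "z0 = of_real r"
    by (metis complex_is_Real_iff Reals_cases)
  have r_nz: "r \<noteq> 0" using r z0_nz by simp
  define m where "m = 2 / (3 * r)"
  have m: "\<mu>0 = of_real m"
    using c2 r r_nz by (simp add: m_def field_simps)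
  have "complex_of_real (6 * r\<^sup>2 + 2 * k\<^sup>2) = of_real (3 * k\<^sup>2 * (A + B) * r)"
    using quad r by (simp add: K_def S_def)
  then have rq: "6 * r\<^sup>2 + 2 * k\<^sup>2 = 3 * k\<^sup>2 * (A + B) * r"
    using of_real_eq_iff by blast
  have "0 < 6 * r\<^sup>2 + 2 * k\<^sup>2" using k by (simp add: add_nonneg_pos)
  then have "0 < (3 * k\<^sup>2 * (A + B)) * r" using rq by simp
  moreover have "0 < 3 * k\<^sup>2 * (A + B)" using AB k by simp
  ultimately have "r > 0" by (rule zero_less_mult_pos)
  then have m_pos: "m > 0" by (simp add: m_def)
  \<comment> \<open>At \<open>z = - k\<close> and at \<open>z = k\<close> the terms with
    \<open>\<mu>0\<close> on the left of \<open>P\<close> cancel, and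
    \<open>(A + B) + (A - B)\<close> or \<open>(A + B) - (A - B)\<close> remains as
    coefficient.\<close>
  have "complex_of_real (2 * A * k ^ 3) = of_real (m * (k + r) ^ 3)"
    using P[of "- of_real k"] unfolding K_def S_def C_def r m
    by (simp add: power3_eq_cube power2_eq_square) algebra
  then have eA: "2 * A * k ^ 3 = m * (k + r) ^ 3"
    using of_real_eq_iff by blast
  have "complex_of_real (2 * B * k ^ 3) = of_real (m * (k - r) ^ 3)"
    using P[of "of_real k"] unfolding K_def S_def C_def r m
    by (simp add: power3_eq_cube power2_eq_square) algebra
  then have eB: "2 * B * k ^ 3 = m * (k - r) ^ 3"
    using of_real_eq_iff by blast
  have "k + r \<noteq> 0" "k - r \<noteq> 0"
    using eA eB AB k by auto
  then show thesis using that m r m_pos r_nz eA eB by blast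
qed

section \<open>Derivatives of an amplitude times a phase\<close>

lemma deriv_twice:
  assumes "open S" "z \<in> S"
    and d: "\<And>w. w \<in> S \<Longrightarrow> (f has_field_derivative f' w) (at w)"
    and d2: "(f' has_field_derivative D) (at z)"
  shows "deriv f z = f' z" and "deriv (deriv f) z = D"
proof -
  show "deriv f z = f' z"
    using d assms(2) by (blast intro: DERIV_imp_deriv)
  \<comment> \<open>Differentiating once more depends only on the first derivative near
    \<open>z\<close>, where its formula is known.\<close>
  have "\<forall>\<^sub>F w in nhds z. deriv f w = f' w"
    using eventually_nhds_in_open[OF assms(1,2)] by eventually_elim (blast intro: DERIV_imp_deriv d)
  then have "deriv (deriv f) z = deriv f' z"
    by (rule deriv_cong_ev) simp
  then show "deriv (deriv f) z = D"
    using d2 by (simp add: DERIV_imp_deriv)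
qed

lemma deriv_amplitude_phase:
  fixes h h' \<theta> \<theta>' :: "complex \<Rightarrow> complex" and c :: complex
  assumes "open S" "z \<in> S"
    and h: "\<And>w. w \<in> S \<Longrightarrow> (h has_field_derivative h' w) (at w)"
    and h2: "(h' has_field_derivative h'') (at z)"
    and \<theta>: "\<And>w. w \<in> S \<Longrightarrow> (\<theta> has_field_derivative \<theta>' w) (at w)"
    and \<theta>2: "(\<theta>' has_field_derivative \<theta>'') (at z)"
  defines "f \<equiv> \<lambda>w. c * h w * exp (\<i> * \<theta> w)"
  shows "deriv f z = c * exp (\<i> * \<theta> z) * (h' z + \<i> * \<theta>' z * h z)"
    and "deriv (deriv f) z = c * exp (\<i> * \<theta> z) *
      (h'' + 2 * \<i> * \<theta>' z * h' z + (\<i> * \<theta>'' - (\<theta>' z)\<^sup>2) * h z)"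
proof -
  define f' where "f' = (\<lambda>w. c * exp (\<i> * \<theta> w) * (h' w + \<i> * \<theta>' w * h w))"
  have d: "(f has_field_derivative f' w) (at w)" if "w \<in> S" for w
    unfolding f_def f'_def
    by (auto intro!: derivative_eq_intros h \<theta> that simp: algebra_simps)
  have d2: "(f' has_field_derivative c * exp (\<i> * \<theta> z) *
      (h'' + 2 * \<i> * \<theta>' z * h' z + (\<i> * \<theta>'' - (\<theta>' z)\<^sup>2) * h z)) (at z)"
    unfolding f'_def
    by (rule derivative_eq_intros refl h \<theta> h2 \<theta>2 assms(2))+
       (simp add: algebra_simps power2_eq_square)
  show "deriv f z = c * exp (\<i> * \<theta> z) * (h' z + \<i> * \<theta>' z * h z)"
    using deriv_twice(1)[OF assms(1,2) d d2] by (simp add: f'_def)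
  show "deriv (deriv f) z = c * exp (\<i> * \<theta> z) *
      (h'' + 2 * \<i> * \<theta>' z * h' z + (\<i> * \<theta>'' - (\<theta>' z)\<^sup>2) * h z)"
    by (rule deriv_twice(2)[OF assms(1,2) d d2])
qed

text \<open>\<open>exp (\<i> \<theta>)\<close> times \<open>dressed p q v n\<close>, where \<open>p = \<theta>'\<close> and \<open>q = \<theta>''\<close>, is the \<open>n\<close>-th derivative
  (\<open>n \<le> 2\<close>) of \<open>v exp (\<i> \<theta>)\<close>; \<open>v n\<close> stands for the \<open>n\<close>-th derivative of the amplitude.\<close>
definition dressed :: "real \<Rightarrow> real \<Rightarrow> (nat \<Rightarrow> real) \<Rightarrow> nat \<Rightarrow> complex" where
  "dressed p q v n =
     (if n = 0 then of_real (v 0)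
      else if n = 1 then of_real (v 1) + \<i> * of_real p * of_real (v 0)
      else of_real (v 2) + 2 * \<i> * of_real p * of_real (v 1)
             + (\<i> * of_real q - (of_real p)\<^sup>2) * of_real (v 0))"

text \<open>The sequences \<open>amp0\<close>, \<open>amp1 k r\<close>, \<open>amp2 k r\<close> list
  the derivatives at \<open>r\<close> of 1, \<open>h1 k\<close>, \<open>h2 k\<close>. Keeping the
  wave factors apart makes them real.\<close>

definition amp0 :: "nat \<Rightarrow> real" where
  "amp0 n = (if n = 0 then 1 else 0)"

definition amp1 :: "real \<Rightarrow> real \<Rightarrow> nat \<Rightarrow> real" where
  "amp1 k r n = (-1) ^ n * fact n * k / (k + r) ^ Suc n"

definition amp2 :: "real \<Rightarrow> real \<Rightarrow> nat \<Rightarrow> real" where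
  "amp2 k r n = fact n * k / (k - r) ^ Suc n"

lemma complex_amp:
  "complex_of_real (amp1 k r 1) = - of_real k / (of_real k + of_real r)\<^sup>2"
  "complex_of_real (amp1 k r 2) = 2 * of_real k / (of_real k + of_real r) ^ 3"
  "complex_of_real (amp2 k r 1) = of_real k / (of_real k - of_real r)\<^sup>2"
  "complex_of_real (amp2 k r 2) = 2 * of_real k / (of_real k - of_real r) ^ 3"
  by (simp_all add: amp1_def amp2_def power2_eq_square power3_eq_cube)

text \<open>The \<open>J\<close>-products of the amplitude derivatives without the phase:
  \<open>m\<close>, \<open>A\<close>, \<open>B\<close> are the squared moduli of the three constant
  factors.\<close>

definition gram :: "real \<Rightarrow> real \<Rightarrow> real \<Rightarrow> real \<Rightarrow> real \<Rightarrow> nat \<Rightarrow> nat \<Rightarrow> real" where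
  "gram A B k m r i j =
     m * amp0 i * amp0 j - A * amp1 k r i * amp1 k r j - B * amp2 k r i * amp2 k r j"

text \<open>All components share one phase, so a single pair \<open>p\<close>, \<open>q\<close>,
  depending on \<open>x\<close> and \<open>t\<close>, serves every component and order. This lets
  the phase terms cancel later.\<close>

lemma Yvec_dressed:
  assumes r: "r \<noteq> 0" "k + r \<noteq> 0" "k - r \<noteq> 0"
  obtains p q where
    "\<And>lam n. n \<le> 2 \<Longrightarrow> Yvec A B a1 a2 k lam (of_real r) n x t =
       phase A B k x t (of_real r) *s
         vector [lam * dressed p q amp0 n,
                 u10 A a1 k x t * dressed p q (amp1 k r) n,
                 u20 B a2 k x t * dressed p q (amp2 k r) n]"
proof -
  define c where "c = 2 - k * (A - B)"
  define \<theta> \<theta>' :: "complex \<Rightarrow> complex" where "\<theta> = (\<lambda>z. z * of_real x + nu A B k z * of_real t)"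
    and "\<theta>' = (\<lambda>z. of_real x - of_real (c * t) / (2 * z\<^sup>2))"
  \<comment> \<open>First and second derivatives of \<open>\<theta>\<close> at
    \<open>r\<close>.\<close>
  define p q where "p = x - c * t / (2 * r\<^sup>2)" and "q = c * t / r ^ 3"
  \<comment> \<open>The removed points are the poles of \<open>nu\<close>, \<open>h2\<close> and
    \<open>h1\<close>.\<close>
  define S where "S = - {0, complex_of_real k, - of_real k}"
  let ?z = "complex_of_real r"
  have S: "open S" unfolding S_def by (intro open_Compl finite_imp_closed) auto
  have zS: "?z \<in> S"
    using r unfolding S_def by (auto simp flip: of_real_minus)
  have nz: "w \<noteq> 0" "of_real k + w \<noteq> 0" "of_real k - w \<noteq> 0" if "w \<in> S" for w
    using that unfolding S_def by (auto simp: add_eq_0_iff)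
  have dt: "(\<theta> has_field_derivative \<theta>' w) (at w)" if "w \<in> S" for w
    unfolding \<theta>_def \<theta>'_def nu_def c_def
    using nz[OF that] by (auto intro!: derivative_eq_intros simp: field_simps power2_eq_square)
  have dt2: "(\<theta>' has_field_derivative of_real q) (at ?z)"
    unfolding \<theta>'_def q_def
    using r by (auto intro!: derivative_eq_intros simp: field_simps power2_eq_square power3_eq_cube)
  have tz: "\<theta>' ?z = of_real p"
    by (simp add: \<theta>'_def p_def)
  have ph: "phase A B k x t w = exp (\<i> * \<theta> w)" for w
    by (simp add: phase_def \<theta>_def)
  define P Q where "P = of_real k + ?z" and "Q = of_real k - ?z"
  have PQ: "P \<noteq> 0" "Q \<noteq> 0"
    using nz[OF zS] by (auto simp: P_def Q_def)
  have key: "(deriv ^^ n) (\<lambda>w. C * h w * phase A B k x t w) ?z = phase A B k x t ?z * (C * dressed p q v n)"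
    if h: "\<And>w. w \<in> S \<Longrightarrow> (h has_field_derivative h' w) (at w)"
      and h2: "(h' has_field_derivative of_real (v 2)) (at ?z)"
      and v: "h ?z = of_real (v 0)" "h' ?z = of_real (v 1)" and n: "n \<le> 2"
    for C h h' v and n :: nat
  proof -
    note D = deriv_amplitude_phase[OF S zS h h2 dt dt2, of C]
    from n consider "n = 0" | "n = 1" | "n = 2" by linarith
    then show ?thesis
      by cases ((simp add: dressed_def D v tz ph numeral_2_eq_2; simp add: mult_ac)+)
  qed
  have k0: "(deriv ^^ n) (\<lambda>w. lam * 1 * phase A B k x t w) ?z
      = phase A B k x t ?z * (lam * dressed p q amp0 n)" if "n \<le> 2" for lam n
    by (rule key[where h' = "\<lambda>_. 0"]) (use that in \<open>auto simp: amp0_def\<close>)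
  have k1: "(deriv ^^ n) (\<lambda>w. C * h1 k w * phase A B k x t w) ?z
      = phase A B k x t ?z * (C * dressed p q (amp1 k r) n)" if "n \<le> 2" for C n
  proof (rule key[where h' = "\<lambda>w. - of_real k / (of_real k + w)\<^sup>2"])
    show "(h1 k has_field_derivative - of_real k / (of_real k + w)\<^sup>2) (at w)" if "w \<in> S" for w
      unfolding h1_def using nz[OF that]
      by (auto intro!: derivative_eq_intros simp: power2_eq_square)
    show "((\<lambda>w. - of_real k / (of_real k + w)\<^sup>2) has_field_derivative of_real (amp1 k r 2)) (at ?z)"
      unfolding complex_amp
      by (rule derivative_eq_intros refl | fold P_def)+
         (use PQ in \<open>simp_all add: field_simps power2_eq_square power3_eq_cube flip: P_def\<close>)
  qed (use that in \<open>auto simp: amp1_def h1_def power2_eq_square\<close>)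
  have k2: "(deriv ^^ n) (\<lambda>w. C * h2 k w * phase A B k x t w) ?z
      = phase A B k x t ?z * (C * dressed p q (amp2 k r) n)" if "n \<le> 2" for C n
  proof (rule key[where h' = "\<lambda>w. of_real k / (of_real k - w)\<^sup>2"])
    show "(h2 k has_field_derivative of_real k / (of_real k - w)\<^sup>2) (at w)" if "w \<in> S" for w
      unfolding h2_def using nz[OF that]
      by (auto intro!: derivative_eq_intros simp: power2_eq_square)
    show "((\<lambda>w. of_real k / (of_real k - w)\<^sup>2) has_field_derivative of_real (amp2 k r 2)) (at ?z)"
      unfolding complex_amp
      by (rule derivative_eq_intros refl | fold Q_def)+
         (use PQ in \<open>simp_all add: field_simps power2_eq_square power3_eq_cube flip: Q_def\<close>)
  qed (use that in \<open>auto simp: amp2_def h2_def power2_eq_square\<close>)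
  show thesis
  proof (rule that)
    show "Yvec A B a1 a2 k lam (of_real r) n x t =
       phase A B k x t (of_real r) *s
         vector [lam * dressed p q amp0 n,
                 u10 A a1 k x t * dressed p q (amp1 k r) n,
                 u20 B a2 k x t * dressed p q (amp2 k r) n]"
      if "n \<le> 2" for lam n
      using k0[OF that, of lam] k1[OF that] k2[OF that]
      by (simp add: vec_eq_iff forall_3 Yvec_def yvec_def)
  qed
qed

section \<open>The \<open>J\<close>-form and the Gram matrix\<close>

lemma Jform_3: "Jform f g = cnj (f $ 1) * g $ 1 - cnj (f $ 2) * g $ 2 - cnj (f $ 3) * g $ 3"
  by (simp add: Jform_def Jmat_def sum_3 matrix_vector_mult_def)

lemma Jform_add_left: "Jform (f + f') g = Jform f g + Jform f' g"
  and Jform_add_right: "Jform f (g + g') = Jform f g + Jform f g'"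
  and Jform_scale_left: "Jform (c *s f) g = cnj c * Jform f g"
  and Jform_scale_right: "Jform f (c *s g) = c * Jform f g"
  by (simp_all add: Jform_3 algebra_simps)

lemma cnj_plane_wave: "cnj (plane_wave a \<kappa> \<omega> x t) * plane_wave a \<kappa> \<omega> x t = of_real (a\<^sup>2)"
  by (simp add: plane_wave_def exp_cnj mult.assoc mult.left_commute[of "exp _"] power2_eq_square flip: exp_add)

lemma cnj_phase: "cnj (phase A B k x t (of_real r)) * phase A B k x t (of_real r) = 1"
  by (simp add: phase_def nu_def exp_cnj flip: exp_add)

lemma gram_symmetric: "gram A B k m r i j = gram A B k m r j i"
  by (simp add: gram_def mult_ac)

text \<open>With \<open>K(a, b)\<close> the \<open>J\<close>-product of the amplitude vectors at \<open>a\<close> and \<open>b\<close>, \<open>K\<close> is the divided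
  difference of \<open>F(\<chi>; \<mu>0) / (\<chi>\<^sup>2 - k\<^sup>2)\<close>, so at a triple root it starts with a multiple of
  \<open>s\<^sup>2 + s t + t\<^sup>2\<close>. These are the resulting relations between its Taylor coefficients.\<close>
lemma gram_relations:
  assumes k: "k \<noteq> 0" "k + r \<noteq> 0" "k - r \<noteq> 0"
    and eA: "2 * A * k ^ 3 = m * (k + r) ^ 3" and eB: "2 * B * k ^ 3 = m * (k - r) ^ 3"
  shows "gram A B k m r 0 0 = 0" "gram A B k m r 0 1 = 0"
    "gram A B k m r 0 2 = 2 * gram A B k m r 1 1"
proof -
  define p q where "p = k + r" and "q = k - r"
  have pq: "p \<noteq> 0" "q \<noteq> 0" and k2: "k = (p + q) / 2" using k by (auto simp: p_def q_def)
  have A: "A = m * p ^ 3 / (2 * k ^ 3)" and B: "B = m * q ^ 3 / (2 * k ^ 3)"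
    using eA eB k by (auto simp: p_def q_def field_simps)
  \<comment> \<open>The cubes in \<open>A\<close> and \<open>B\<close> leave terms linear in
    \<open>p\<close> and \<open>q\<close>, and \<open>p + q = 2 * k\<close>.\<close>
  have "A * (k / p) * (k / p) = m * p / (2 * k)" "B * (k / q) * (k / q) = m * q / (2 * k)"
    unfolding A B using pq k by (simp_all add: field_simps power3_eq_cube)
  moreover have "m * p / (2 * k) + m * q / (2 * k) = m"
    using k by (simp add: p_def q_def field_simps)
  ultimately show "gram A B k m r 0 0 = 0"
    by (simp add: gram_def amp0_def amp1_def amp2_def flip: p_def q_def)
  \<comment> \<open>Equal values cancel, since \<open>amp1\<close> and \<open>amp2\<close> have
    first derivatives of opposite form \<open>- k / p\<^sup>2\<close> and
    \<open>k / q\<^sup>2\<close>.\<close>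
  have "A * (k / p) * (k / p\<^sup>2) = m / (2 * k)" "B * (k / q) * (k / q\<^sup>2) = m / (2 * k)"
    unfolding A B using pq k by (simp_all add: field_simps power3_eq_cube power2_eq_square)
  then show "gram A B k m r 0 1 = 0"
    by (simp add: gram_def amp0_def amp1_def amp2_def power2_eq_square flip: p_def q_def)
  \<comment> \<open>Termwise: \<open>h * h'' = 2 * h'\<^sup>2\<close> for both simple fractions
    \<open>h\<close>.\<close>
  show "gram A B k m r 0 2 = 2 * gram A B k m r 1 1"
    using pq by (simp add: gram_def amp0_def amp1_def amp2_def field_simps eval_nat_numeral flip: p_def q_def)
qed

text \<open>On expansion, \<open>p\<close> and \<open>q\<close> multiply only \<open>g00\<close>,
  \<open>g01\<close> and \<open>g02 - 2 g11\<close>, all of which vanish.\<close>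

lemma dressed_gram:
  fixes A B k m r p q :: real
  assumes rel: "gram A B k m r 0 0 = 0" "gram A B k m r 0 1 = 0"
      "gram A B k m r 0 2 = 2 * gram A B k m r 1 1"
    and "i \<le> 2" "j \<le> 2"
  shows "of_real m * (cnj (dressed p q amp0 i) * dressed p q amp0 j)
     - of_real A * (cnj (dressed p q (amp1 k r) i) * dressed p q (amp1 k r) j)
     - of_real B * (cnj (dressed p q (amp2 k r) i) * dressed p q (amp2 k r) j)
     = complex_of_real (gram A B k m r i j)"
proof -
  have R: "m * amp0 0 * amp0 0 = A * amp1 k r 0 * amp1 k r 0 + B * amp2 k r 0 * amp2 k r 0"
    "m * amp0 0 * amp0 1 = A * amp1 k r 0 * amp1 k r 1 + B * amp2 k r 0 * amp2 k r 1"
    "m * amp0 0 * amp0 2 - A * amp1 k r 0 * amp1 k r 2 - B * amp2 k r 0 * amp2 k r 2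
      = 2 * (m * amp0 1 * amp0 1 - A * amp1 k r 1 * amp1 k r 1 - B * amp2 k r 1 * amp2 k r 1)"
    using rel by (simp_all add: gram_def)
  obtain a0 a1 a2 b0 b1 b2 c0 c1 c2 where v: "amp0 0 = a0" "amp0 1 = a1" "amp0 2 = a2"
    "amp1 k r 0 = b0" "amp1 k r 1 = b1" "amp1 k r 2 = b2"
    "amp2 k r 0 = c0" "amp2 k r 1 = c1" "amp2 k r 2 = c2"
    by blast
  note R = R[unfolded v]
  let ?goal = "\<lambda>i j. of_real m * (cnj (dressed p q amp0 i) * dressed p q amp0 j)
     - of_real A * (cnj (dressed p q (amp1 k r) i) * dressed p q (amp1 k r) j)
     - of_real B * (cnj (dressed p q (amp2 k r) i) * dressed p q (amp2 k r) j)
     = complex_of_real (gram A B k m r i j)"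
  have "?goal 0 0" "?goal 0 1" "?goal 0 2" "?goal 1 0" "?goal 1 1" "?goal 1 2"
    "?goal 2 0" "?goal 2 1"
    by ((rule complex_eqI; insert R; simp (no_asm) add: dressed_def gram_def v power2_eq_square del: One_nat_def; algebra)+)
  \<comment> \<open>The left side is the surplus of the product at (2,2) over
    \<open>gram\<close>.\<close>
  moreover have "(p * p * p * p + q * q) * (m * a0 * a0 - A * b0 * b0 - B * c0 * c0)
      + 4 * p * q * (m * a0 * a1 - A * b0 * b1 - B * c0 * c1)
      - 2 * p * p * (m * a0 * a2 - A * b0 * b2 - B * c0 * c2)
      + 4 * p * p * (m * a1 * a1 - A * b1 * b1 - B * c1 * c1) = 0"
    using R by simp
  then have "?goal 2 2"
    by (intro complex_eqI)
       (simp_all (no_asm) add: dressed_def gram_def v power2_eq_square del: One_nat_def, simp_all add: algebra_simps)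
  moreover have "i = 0 \<or> i = 1 \<or> i = 2" "j = 0 \<or> j = 1 \<or> j = 2" using assms by linarith+
  ultimately show ?thesis by (elim disjE) (simp_all only:)
qed

section \<open>Null vectors at a triple root\<close>

theorem proposition32:
  fixes A B a1 a2 k :: real and \<mu>0 z0 :: complex
  assumes "A > 0" and "B > 0" and "k \<noteq> 0"
    and "a1\<^sup>2 = A" and "a2\<^sup>2 = B"
    and triple_root: "\<forall>z. spatial_poly A B k \<mu>0 z = \<mu>0 * (z - z0) ^ 3"
  shows "\<exists>g :: nat \<Rightarrow> nat \<Rightarrow> real.
    (\<forall>m\<le>2. \<forall>n\<le>2. \<forall>x t.
       Jform (Ytriple A B a1 a2 k \<mu>0 z0 m x t) (Ytriple A B a1 a2 k \<mu>0 z0 n x t)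
         = of_real (g m n)) \<and>
    (\<forall>M0 M1 M2 x t.
       y_R A B a1 a2 k \<mu>0 z0 M0 M1 M2 x t \<noteq> 0 \<and> J_null (y_R A B a1 a2 k \<mu>0 z0 M0 M1 M2 x t)
         \<longrightarrow> M0 \<noteq> 0) \<and>
    (\<forall>M1 M2 x t.
       J_null (y_R A B a1 a2 k \<mu>0 z0 1 M1 M2 x t) \<longleftrightarrow>
         g 1 1 * (cmod M1)\<^sup>2 + g 0 2 * Re M2 + Re (of_real (g 1 2) * cnj M1 * M2)
           + g 2 2 / 4 * (cmod M2)\<^sup>2 = 0)"
proof -
  obtain m r where m: "\<mu>0 = of_real m" "m > 0" and r: "z0 = of_real r" "r \<noteq> 0"
    and nz: "k + r \<noteq> 0" "k - r \<noteq> 0"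
    and eA: "2 * A * k ^ 3 = m * (k + r) ^ 3" and eB: "2 * B * k ^ 3 = m * (k - r) ^ 3"
    using triple_root_parameters[OF assms(1-3) triple_root] by metis
  define g where "g = gram A B k m r"
  note rel = gram_relations[OF assms(3) nz eA eB]
  define Y where "Y = Ytriple A B a1 a2 k \<mu>0 z0"
  have lam: "cnj (csqrt \<mu>0) * csqrt \<mu>0 = of_real m"
    using m by (simp add: of_real_sqrt[symmetric] flip: of_real_mult)
  have products: "Jform (Y i x t) (Y j x t) = of_real (g i j)" if ij: "i \<le> 2" "j \<le> 2" for i j x t
  proof -
    obtain p q where pq: "\<And>lam n. n \<le> 2 \<Longrightarrow> Yvec A B a1 a2 k lam (of_real r) n x t =
       phase A B k x t (of_real r) *s
         vector [lam * dressed p q amp0 n,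
                 u10 A a1 k x t * dressed p q (amp1 k r) n,
                 u20 B a2 k x t * dressed p q (amp2 k r) n]"
      using Yvec_dressed[OF r(2) nz] by metis
    let ?E = "phase A B k x t (of_real r)" and ?u = "u10 A a1 k x t" and ?v = "u20 B a2 k x t"
    have uv: "cnj ?u * ?u = of_real A" "cnj ?v * ?v = of_real B"
      by (simp_all only: u10_def u20_def cnj_plane_wave assms)
    have "Jform (Y i x t) (Y j x t) = (cnj ?E * ?E) *
       ((cnj (csqrt \<mu>0) * csqrt \<mu>0) * (cnj (dressed p q amp0 i) * dressed p q amp0 j)
     - (cnj ?u * ?u) * (cnj (dressed p q (amp1 k r) i) * dressed p q (amp1 k r) j)
     - (cnj ?v * ?v) * (cnj (dressed p q (amp2 k r) i) * dressed p q (amp2 k r) j))"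
      by (simp add: Y_def Ytriple_def r(1) pq ij Jform_3 algebra_simps del: csqrt_of_real)
    also have "\<dots> = of_real (g i j)"
      unfolding cnj_phase lam uv g_def mult_1 by (rule dressed_gram[OF rel ij])
    finally show ?thesis .
  qed
  have yR: "y_R A B a1 a2 k \<mu>0 z0 M0 M1 M2 x t = M0 *s Y 0 x t + M1 *s Y 1 x t + (M2 / 2) *s Y 2 x t"
    for M0 M1 M2 x t
    by (simp add: y_R_def Y_def)
  have g: "g 0 0 = 0" "g 0 1 = 0" "g 1 0 = 0" "g 2 0 = g 0 2" "g 2 1 = g 1 2"
    using rel gram_symmetric[of A B k m r] by (simp_all add: g_def)
  \<comment> \<open>Since \<open>g00 = g01 = 0\<close>, \<open>M0\<close> enters only through its
    pairing with \<open>M2\<close>.\<close>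
  have form: "Jform (y_R A B a1 a2 k \<mu>0 z0 M0 M1 M2 x t) (y_R A B a1 a2 k \<mu>0 z0 M0 M1 M2 x t)
      = of_real (g 1 1 * (cmod M1)\<^sup>2 + g 0 2 * Re (cnj M0 * M2) + Re (of_real (g 1 2) * cnj M1 * M2)
           + g 2 2 / 4 * (cmod M2)\<^sup>2)" for M0 M1 M2 x t
  proof -
    have "Jform (y_R A B a1 a2 k \<mu>0 z0 M0 M1 M2 x t) (y_R A B a1 a2 k \<mu>0 z0 M0 M1 M2 x t)
      = cnj M1 * M1 * of_real (g 1 1) + (cnj M0 * M2 + cnj M2 * M0) / 2 * of_real (g 0 2)
        + (cnj M1 * M2 + cnj M2 * M1) / 2 * of_real (g 1 2) + cnj M2 * M2 / 4 * of_real (g 2 2)"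
      unfolding yR Jform_add_left Jform_add_right Jform_scale_left Jform_scale_right
      by (simp add: products g algebra_simps add_divide_distrib del: One_nat_def)
    then show ?thesis
      unfolding cmod_power2 by (simp add: complex_eq_iff field_simps power2_eq_square)
  qed
  show ?thesis
  proof (intro exI[of _ g] conjI allI impI)
    show "Jform (Ytriple A B a1 a2 k \<mu>0 z0 i x t) (Ytriple A B a1 a2 k \<mu>0 z0 j x t) = of_real (g i j)"
      if "i \<le> 2" "j \<le> 2" for i j x t
      using products[OF that] by (simp add: Y_def)
    show "J_null (y_R A B a1 a2 k \<mu>0 z0 1 M1 M2 x t) \<longleftrightarrow>
         g 1 1 * (cmod M1)\<^sup>2 + g 0 2 * Re M2 + Re (of_real (g 1 2) * cnj M1 * M2)
           + g 2 2 / 4 * (cmod M2)\<^sup>2 = 0" for M1 M2 x t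
      unfolding J_null_def form of_real_eq_0_iff by simp
    fix M0 M1 M2 x t
    assume *: "y_R A B a1 a2 k \<mu>0 z0 M0 M1 M2 x t \<noteq> 0 \<and> J_null (y_R A B a1 a2 k \<mu>0 z0 M0 M1 M2 x t)"
    show "M0 \<noteq> 0"
    proof
      assume M0: "M0 = 0"
      \<comment> \<open>Up to wave factors, the last two components of the combination of amplitude
        derivatives. The first is zero, so the form is minus a positive sum of squares.\<close>
      define X Z where "X = M1 * of_real (amp1 k r 1) + M2 / 2 * of_real (amp1 k r 2)"
        and "Z = M1 * of_real (amp2 k r 1) + M2 / 2 * of_real (amp2 k r 2)"
      have "g 1 1 * (cmod M1)\<^sup>2 + Re (of_real (g 1 2) * cnj M1 * M2) + g 2 2 / 4 * (cmod M2)\<^sup>2 = 0"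
        using * unfolding J_null_def form M0 of_real_eq_0_iff by simp
      then have "A * (cmod X)\<^sup>2 + B * (cmod Z)\<^sup>2 = 0"
        unfolding X_def Z_def g_def gram_def cmod_power2
        by (simp add: amp0_def algebra_simps power2_eq_square add_divide_distrib)
      then have "(cmod X)\<^sup>2 = 0 \<and> (cmod Z)\<^sup>2 = 0"
        using assms(1,2) by (simp add: add_nonneg_eq_0_iff)
      then have XZ: "X = 0" "Z = 0" by auto
      define P Q where "P = complex_of_real k + of_real r" and "Q = complex_of_real k - of_real r"
      have PQ: "P \<noteq> 0" "Q \<noteq> 0"
        using nz by (simp_all add: P_def Q_def flip: of_real_add of_real_diff)
      have amps: "of_real (amp1 k r 1) = - of_real k / P\<^sup>2" "of_real (amp1 k r 2) = 2 * of_real k / P ^ 3"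
        "of_real (amp2 k r 1) = of_real k / Q\<^sup>2" "of_real (amp2 k r 2) = 2 * of_real k / Q ^ 3"
        by (simp_all only: complex_amp P_def Q_def)
      have "X = - of_real k / P ^ 3 * (M1 * P - M2)" "Z = of_real k / Q ^ 3 * (M1 * Q + M2)"
        using PQ unfolding X_def Z_def amps by (simp_all add: field_simps power2_eq_square power3_eq_cube)
      \<comment> \<open>Adding these gives \<open>2 * k * M1 = 0\<close>, as
        \<open>P + Q = 2 * k\<close>.\<close>
      then have MP: "M1 * P = M2" and MQ: "M1 * Q = - M2"
        using XZ PQ assms(3) by (auto simp: eq_neg_iff_add_eq_0)
      then have "M1 * P + M1 * Q = 0" by simp
      then have "M1 * (2 * of_real k) = 0" by (simp add: P_def Q_def algebra_simps)
      then have "M1 = 0" using assms(3) by simp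
      moreover then have "M2 = 0" using MP by simp
      ultimately show False using * M0 by (simp add: yR)
    qed
  qed
qed

end
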